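(* Let $n\ge1$ be an integer. Given constants $B>0$, $C<1$ and $\varepsilon\le C$ (real numbers), let $$M=\left((1-C)B\kappa_n\right)^{\frac1{1-\varepsilon}}>0.$$ Suppose the function $u:D_1\to\mathbb{R}$ satisfies: (i) $u\in\mathcal{C}^2(D_1)$; (ii) $u(\vec x)>0$ for $\vec x\in D_1$; (iii) for all $\vec x\in D_1$, $$u(\vec x)\Delta u(\vec x)\ge B|u(\vec x)|^{1+\varepsilon}+C|\vec\nabla u(\vec x)|^2.$$ Then $\displaystyle\sup_{\vec x\in D_1}u(\vec x)>M$.
   Context: $D_r$ denotes the open ball of radius $r$ in $\mathbb{R}^n$ centered at the origin. Let $\beta_n(r)=\int_{D_r}dV$ be the volume of $D_r\subseteq\mathbb{R}^n$ and let $\sigma_n(r)=\int_{\partial D_r}dA$ be the $(n-1)$-dimensional surface measure of its boundary $\partial D_r$. Define $$\kappa_n=\frac{\int_0^1\beta_n(r)\,dr}{\sigma_n(1)},$$ so $\kappa_1=\frac12$, $\kappa_2=\frac16$, $\kappa_3=\frac1{12}$, and so on. *)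

theory Defs
  imports "HOL-Analysis.Analysis"
begin

section \<open>Differential calculus of real functions on \<open>real ^ 'n\<close>\<close>

definition partial_deriv :: "'n::finite \<Rightarrow> (real ^ 'n \<Rightarrow> real) \<Rightarrow> real ^ 'n \<Rightarrow> real" where
  "partial_deriv i f x = frechet_derivative f (at x) (axis i 1)"

definition gradient :: "(real ^ 'n::finite \<Rightarrow> real) \<Rightarrow> real ^ 'n \<Rightarrow> real ^ 'n" where
  "gradient f x = (\<chi> i. partial_deriv i f x)"

definition laplacian :: "(real ^ 'n::finite \<Rightarrow> real) \<Rightarrow> real ^ 'n \<Rightarrow> real" where
  "laplacian f x = (\<Sum>i\<in>UNIV. partial_deriv i (partial_deriv i f) x)"

text \<open>Meant for open \<open>S\<close>: there the derivatives at points of \<open>S\<close> depend only on \<open>f\<close> restricted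
  to \<open>S\<close>.\<close>

primrec Ck_on :: "nat \<Rightarrow> (real ^ 'n::finite) set \<Rightarrow> (real ^ 'n \<Rightarrow> real) \<Rightarrow> bool" where
  "Ck_on 0 S f \<longleftrightarrow> continuous_on S f"
| "Ck_on (Suc k) S f \<longleftrightarrow>
     (\<forall>x\<in>S. f differentiable (at x)) \<and> (\<forall>i. Ck_on k S (partial_deriv i f))"


section \<open>Surface area of graphs and of the sphere\<close>

text \<open>The coordinate hyperplane orthogonal to the \<open>k\<close>-th axis is a copy of Euclidean
  \<open>(n - 1)\<close>-space; its points are the extensional functions on \<open>UNIV - {k}\<close>, and it carries
  \<open>(n - 1)\<close>-dimensional Lebesgue measure.  For \<open>n = 1\<close> it is a single point of mass 1.\<close>

definition hyperplane_measure :: "'n::finite \<Rightarrow> ('n \<Rightarrow> real) measure" where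
  "hyperplane_measure k = (\<Pi>\<^sub>M j\<in>UNIV - {k}. lborel)"

definition graph_point :: "'n::finite \<Rightarrow> (('n \<Rightarrow> real) \<Rightarrow> real) \<Rightarrow> ('n \<Rightarrow> real) \<Rightarrow> real ^ 'n" where
  "graph_point k g y = (\<chi> j. if j = k then g y else y j)"

text \<open>The area of the graph \<open>graph_point k g ` U\<close>, with the usual area element
  \<open>dA = sqrt (1 + |grad g|^2) dy\<close>.\<close>

definition graph_area :: "'n::finite \<Rightarrow> (('n \<Rightarrow> real) \<Rightarrow> real) \<Rightarrow> ('n \<Rightarrow> real) set \<Rightarrow> real" where
  "graph_area k g U =
     (LINT y:U|hyperplane_measure k.
        sqrt (1 + (\<Sum>j\<in>UNIV - {k}. (deriv (\<lambda>t. g (y(j := t))) (y j))\<^sup>2)))"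

definition hyperplane_disc :: "'n::finite \<Rightarrow> real \<Rightarrow> ('n \<Rightarrow> real) set" where
  "hyperplane_disc k r =
     {y \<in> space (hyperplane_measure k). (\<Sum>j\<in>UNIV - {k}. (y j)\<^sup>2) < r\<^sup>2}"

definition hemisphere_fun :: "'n::finite \<Rightarrow> real \<Rightarrow> ('n \<Rightarrow> real) \<Rightarrow> real" where
  "hemisphere_fun k r y = sqrt (r\<^sup>2 - (\<Sum>j\<in>UNIV - {k}. (y j)\<^sup>2))"

lemma sphere_minus_equator:
  fixes k :: "'n::finite"
  assumes "r > 0"
  shows "{x \<in> sphere (0 :: real ^ 'n) r. x $ k > 0} =
           graph_point k (hemisphere_fun k r) ` hyperplane_disc k r"
    and "{x \<in> sphere (0 :: real ^ 'n) r. x $ k < 0} =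
           graph_point k (\<lambda>y. - hemisphere_fun k r y) ` hyperplane_disc k r"
proof -
  have sph: "x \<in> sphere 0 r \<longleftrightarrow> (x $ k)\<^sup>2 + (\<Sum>j\<in>UNIV - {k}. (x $ j)\<^sup>2) = r\<^sup>2" for x :: "real ^ 'n"
  proof -
    have "x \<in> sphere 0 r \<longleftrightarrow> (norm x)\<^sup>2 = r\<^sup>2"
      using assms by (auto simp: power2_eq_iff_nonneg)
    also have "(norm x)\<^sup>2 = (\<Sum>j\<in>UNIV. (x $ j)\<^sup>2)"
      by (simp add: norm_vec_def L2_set_def sum_nonneg)
    also have "\<dots> = (x $ k)\<^sup>2 + (\<Sum>j\<in>UNIV - {k}. (x $ j)\<^sup>2)"
      by (simp add: sum.remove)
    finally show ?thesis .
  qed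
  have sp: "space (hyperplane_measure k) = extensional (UNIV - {k})"
    by (simp add: hyperplane_measure_def space_PiM PiE_def)
  have gp: "(\<Sum>j\<in>UNIV - {k}. (graph_point k g y $ j)\<^sup>2) = (\<Sum>j\<in>UNIV - {k}. (y j)\<^sup>2)"
    "graph_point k g y $ k = g y" for g y
    by (auto simp: graph_point_def intro!: sum.cong)
  have surj: "\<exists>y\<in>hyperplane_disc k r. x = graph_point k (\<lambda>y. s * hemisphere_fun k r y) y"
    if "x \<in> sphere 0 r" "s * x $ k > 0" "s = 1 \<or> s = -1" for x :: "real ^ 'n" and s
  proof -
    define y where "y = restrict (($) x) (UNIV - {k})"
    have S: "(\<Sum>j\<in>UNIV - {k}. (y j)\<^sup>2) = (\<Sum>j\<in>UNIV - {k}. (x $ j)\<^sup>2)"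
      by (simp add: y_def)
    have e: "r\<^sup>2 - (\<Sum>j\<in>UNIV - {k}. (y j)\<^sup>2) = (x $ k)\<^sup>2"
      using that(1) sph[of x] S by linarith
    have "(x $ k)\<^sup>2 > 0" using that(2) by (auto simp: zero_less_mult_iff)
    then have "(\<Sum>j\<in>UNIV - {k}. (y j)\<^sup>2) < r\<^sup>2" using e by linarith
    moreover have "y \<in> extensional (UNIV - {k})" by (simp add: y_def)
    ultimately have "y \<in> hyperplane_disc k r"
      by (simp add: hyperplane_disc_def sp)
    moreover have "s * hemisphere_fun k r y = x $ k"
      using that(2,3) by (auto simp: hemisphere_fun_def e)
    then have "x = graph_point k (\<lambda>y. s * hemisphere_fun k r y) y"
      by (auto simp: graph_point_def y_def vec_eq_iff)
    ultimately show ?thesis by blast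
  qed
  have inj: "hemisphere_fun k r y > 0"
    "(hemisphere_fun k r y)\<^sup>2 + (\<Sum>j\<in>UNIV - {k}. (y j)\<^sup>2) = r\<^sup>2"
    if "y \<in> hyperplane_disc k r" for y
    using that by (auto simp: hyperplane_disc_def hemisphere_fun_def)
  show "{x \<in> sphere (0 :: real ^ 'n) r. x $ k > 0} =
           graph_point k (hemisphere_fun k r) ` hyperplane_disc k r"
    using surj[where s = 1] inj unfolding sph by (auto simp: gp)
  show "{x \<in> sphere (0 :: real ^ 'n) r. x $ k < 0} =
           graph_point k (\<lambda>y. - hemisphere_fun k r y) ` hyperplane_disc k r"
    using surj[where s = "-1"] inj unfolding sph by (auto simp: gp)
qed

text \<open>The area of the sphere of radius \<open>r > 0\<close> is the sum of the areas of its two open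
  hemispheres; the equator \<open>x $ k = 0\<close> has lower dimension and does not contribute.  By symmetry
  the choice of the axis \<open>k\<close> is immaterial.\<close>

definition sphere_area :: "'n::finite itself \<Rightarrow> real \<Rightarrow> real" where
  "sphere_area _ r = (let k = (SOME k :: 'n. True) in
     graph_area k (hemisphere_fun k r) (hyperplane_disc k r) +
     graph_area k (\<lambda>y. - hemisphere_fun k r y) (hyperplane_disc k r))"

definition ball_volume :: "'n::finite itself \<Rightarrow> real \<Rightarrow> real" where
  "ball_volume _ r = measure lborel (ball (0 :: real ^ 'n) r)"

definition kappa :: "'n::finite itself \<Rightarrow> real" where
  "kappa T = integral {0..1} (ball_volume T) / sphere_area T 1"

end

theory Submission
  imports Defs
begin

text \<open>If \<open>u \<le> M\<close> on the ball, then \<open>v = u powr (1 - C)\<close> has Laplacian at least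
  \<open>K = (1 - C) * B * M powr (\<epsilon> - C)\<close>, so the maximum principle for
  \<open>v - K \<bar>x\<bar>\<^sup>2 / (2 n)\<close> gives \<open>0 < v 0 \<le> M powr (1 - C) - K / (2 n)\<close>.  Since
  \<open>M powr (1 - C) = kappa * K\<close> this means \<open>kappa > 1 / (2 n)\<close>, which contradicts
  \<open>kappa = 1 / (n (n + 1))\<close>.\<close>

section \<open>Ball volume by slicing along a coordinate axis\<close>

text \<open>Tonelli in the \<open>k\<close>-th coordinate: the slice of the closed ball over
  \<open>y\<close> is an interval of half-length sqrt(r^2 - |y|^2), or empty when |y| > r. The
  \<open>max 0\<close> makes the formula cover both cases, so the integral can run over the whole
  hyperplane.\<close>

lemma nn_integral_hyperplane_height:
  fixes k :: "'n::finite"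
  assumes r: "r > 0"
  shows "(\<integral>\<^sup>+y. ennreal (2 * sqrt (max 0 (r\<^sup>2 - (\<Sum>j\<in>UNIV - {k}. (y j)\<^sup>2)))) \<partial>hyperplane_measure k) =
           ennreal (unit_ball_vol (real CARD('n)) * r ^ CARD('n))"
proof -
  interpret product_sigma_finite "\<lambda>_::'n. lborel :: real measure"
    by standard
  let ?I = "UNIV - {k}"
  \<comment> \<open>Writing the index set as \<open>insert k ?I\<close> lets the product rule peel
    off the \<open>k\<close>-th factor.\<close>
  let ?P = "Pi\<^sub>M (insert k ?I) (\<lambda>_. lborel :: real measure)"
  let ?A = "{f. sqrt (\<Sum>i\<in>insert k ?I. (f i)\<^sup>2) \<le> r} \<inter> space ?P"
  have "ennreal (unit_ball_vol (real CARD('n)) * r ^ CARD('n)) = emeasure ?P ?A"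
    using emeasure_cball_aux[of "insert k ?I" r] r by (simp add: insert_absorb)
  also have "\<dots> = (\<integral>\<^sup>+f. indicator ?A f \<partial>?P)"
    by (subst nn_integral_indicator) auto
  also have "\<dots> = (\<integral>\<^sup>+y. \<integral>\<^sup>+x. indicator ?A (y(k := x)) \<partial>lborel \<partial>hyperplane_measure k)"
    unfolding hyperplane_measure_def
    by (rule product_nn_integral_insert) auto
  also have "\<dots> = (\<integral>\<^sup>+y. ennreal (2 * sqrt (max 0 (r\<^sup>2 - (\<Sum>j\<in>?I. (y j)\<^sup>2)))) \<partial>hyperplane_measure k)"
  proof (rule nn_integral_cong)
    fix y :: "'n \<Rightarrow> real"
    assume y: "y \<in> space (hyperplane_measure k)"
    let ?S = "\<Sum>j\<in>?I. (y j)\<^sup>2"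
    let ?c = "sqrt (r\<^sup>2 - ?S)"
    have S: "(\<Sum>j\<in>?I. ((y(k := x)) j)\<^sup>2) = ?S" for x
      by (intro sum.cong) auto
    have mem: "y(k := x) \<in> ?A \<longleftrightarrow> x\<^sup>2 + ?S \<le> r\<^sup>2" for x
    proof -
      have "(\<Sum>i\<in>insert k ?I. ((y(k := x)) i)\<^sup>2) = x\<^sup>2 + ?S"
        by (subst sum.insert) (use S in auto)
      moreover have "y(k := x) \<in> space ?P"
        using y by (auto simp: hyperplane_measure_def space_PiM PiE_def extensional_def)
      moreover have "sqrt (x\<^sup>2 + ?S) \<le> r \<longleftrightarrow> x\<^sup>2 + ?S \<le> r\<^sup>2"
        using r by (intro real_sqrt_le_iff') (auto intro!: add_nonneg_nonneg sum_nonneg)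
      ultimately show ?thesis by simp
    qed
    have "(\<integral>\<^sup>+x. indicator ?A (y(k := x)) \<partial>lborel) = (\<integral>\<^sup>+x. indicator {x. x\<^sup>2 + ?S \<le> r\<^sup>2} x \<partial>lborel)"
      by (intro nn_integral_cong) (simp only: indicator_def mem mem_Collect_eq)
    also have "\<dots> = emeasure lborel {x. x\<^sup>2 + ?S \<le> r\<^sup>2}"
      by (subst nn_integral_indicator) auto
    also have "\<dots> = ennreal (2 * sqrt (max 0 (r\<^sup>2 - ?S)))"
    proof (cases "?S \<le> r\<^sup>2")
      case True
      have "x\<^sup>2 + ?S \<le> r\<^sup>2 \<longleftrightarrow> \<bar>x\<bar> \<le> ?c" for x
        using True real_sqrt_le_iff[of "x\<^sup>2" "r\<^sup>2 - ?S"] by (simp add: algebra_simps)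
      then have "{x. x\<^sup>2 + ?S \<le> r\<^sup>2} = {- ?c..?c}"
        by (simp only: set_eq_iff mem_Collect_eq atLeastAtMost_iff abs_le_iff minus_le_iff conj_commute)
          blast
      then show ?thesis using True by (simp only: emeasure_lborel_Icc_eq) simp
    next
      case False
      then have "\<not> x\<^sup>2 + ?S \<le> r\<^sup>2" for x
        using zero_le_power2[of x] by linarith
      then have "{x. x\<^sup>2 + ?S \<le> r\<^sup>2} = {}"
        by blast
      then show ?thesis using False by (simp add: max_def)
    qed
    finally show "(\<integral>\<^sup>+x. indicator ?A (y(k := x)) \<partial>lborel) = ennreal (2 * sqrt (max 0 (r\<^sup>2 - ?S)))" .
  qed
  finally show ?thesis ..
qed

lemma sum_squares_measurable [measurable]:
  fixes k :: "'n::finite"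
  shows "(\<lambda>y. \<Sum>j\<in>UNIV - {k}. (y j)\<^sup>2) \<in> borel_measurable (hyperplane_measure k)"
  unfolding hyperplane_measure_def by measurable

lemma has_bochner_integral_hyperplane_height:
  fixes k :: "'n::finite"
  assumes r: "r > 0"
  shows "has_bochner_integral (hyperplane_measure k)
           (\<lambda>y. sqrt (max 0 (r\<^sup>2 - (\<Sum>j\<in>UNIV - {k}. (y j)\<^sup>2))))
           (unit_ball_vol (real CARD('n)) * r ^ CARD('n) / 2)"
proof -
  have "has_bochner_integral (hyperplane_measure k)
           (\<lambda>y. 2 * sqrt (max 0 (r\<^sup>2 - (\<Sum>j\<in>UNIV - {k}. (y j)\<^sup>2))))
           (unit_ball_vol (real CARD('n)) * r ^ CARD('n))"
    using nn_integral_hyperplane_height[OF r, of k] r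
    by (intro has_bochner_integral_nn_integral) auto
  then have "has_bochner_integral (hyperplane_measure k)
           (\<lambda>y. (1/2) * (2 * sqrt (max 0 (r\<^sup>2 - (\<Sum>j\<in>UNIV - {k}. (y j)\<^sup>2)))))
           ((1/2) * (unit_ball_vol (real CARD('n)) * r ^ CARD('n)))"
    by (intro has_bochner_integral_mult_right) simp
  then show ?thesis by simp
qed

section \<open>Area of the unit sphere and the value of \<open>kappa\<close>\<close>

text \<open>A concrete sequence of steps is taken because Fatou and dominated convergence work along
  sequences. The offset 2 keeps each step strictly below 1, so the radii 1 - step stay positive, as
  the volume formula requires.\<close>

lemma tendsto_left_difference_quotient:
  fixes f :: "real \<Rightarrow> real"
  assumes "(f has_real_derivative D) (at 1)"
  shows "(\<lambda>m. (f 1 - f (1 - inverse (real (m + 2)))) / inverse (real (m + 2))) \<longlonglongrightarrow> D"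
proof -
  have "((\<lambda>h. (f (1 + h) - f 1) / h) \<longlongrightarrow> D) (at 0)"
    using assms by (simp add: DERIV_def)
  moreover have "filterlim (\<lambda>m. - inverse (real (m + 2))) (at 0) sequentially"
    unfolding filterlim_at
    using LIMSEQ_ignore_initial_segment[OF tendsto_minus[OF LIMSEQ_inverse_real_of_nat], of 1]
    by (simp add: add.commute)
  ultimately have "(\<lambda>m. (f (1 + - inverse (real (m + 2))) - f 1) / (- inverse (real (m + 2)))) \<longlonglongrightarrow> D"
    by (rule filterlim_compose)
  then show ?thesis
    by (simp add: minus_divide_left flip: minus_divide_right)
qed

text \<open>The volume of the ball of radius \<open>r\<close> is the integral of twice the height
  \<open>sqrt (r\<^sup>2 - \<bar>y\<bar>\<^sup>2)\<close>, whose derivative in \<open>r\<close> at \<open>1\<close> is the area density of the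
  unit hemisphere.  Fatou's lemma on the difference quotients gives integrability of this unbounded
  density, after which it dominates the same quotients.\<close>

lemma integral_hemisphere_density:
  fixes k :: "'n::finite"
  shows "(LINT y:hyperplane_disc k 1|hyperplane_measure k. 1 / hemisphere_fun k 1 y) =
           real CARD('n) * unit_ball_vol (real CARD('n)) / 2"
proof -
  define S where "S y = (\<Sum>j\<in>UNIV - {k}. (y j)\<^sup>2)" for y :: "'n \<Rightarrow> real"
  define V where "V = unit_ball_vol (real CARD('n))"
  define h where "h r y = sqrt (max 0 (r\<^sup>2 - S y))" for r y
  define d where "d m = inverse (real (m + 2))" for m
  define q where "q m y = (h 1 y - h (1 - d m) y) / d m" for m y
  define w where "w y = indicator (hyperplane_disc k 1) y * (1 / hemisphere_fun k 1 y)" for y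
  let ?M = "hyperplane_measure k"
  have [measurable]: "S \<in> borel_measurable ?M"
    unfolding S_def by measurable
  have [measurable]: "h r \<in> borel_measurable ?M" for r
    unfolding h_def by measurable
  have [measurable]: "q m \<in> borel_measurable ?M" for m
    unfolding q_def by measurable
  have disc: "hyperplane_disc k 1 = {y \<in> space ?M. S y < 1}"
    by (simp add: hyperplane_disc_def S_def)
  have [measurable]: "hyperplane_disc k 1 \<in> sets ?M"
    unfolding disc by measurable
  have hemi: "hemisphere_fun k 1 y = sqrt (1 - S y)" for y
    by (simp add: hemisphere_fun_def S_def)
  have [measurable]: "w \<in> borel_measurable ?M"
    unfolding w_def hemi by measurable
  have S0: "S y \<ge> 0" for y
    by (simp add: S_def sum_nonneg)
  have d: "0 < d m" "d m < 1" for m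
    by (auto simp: d_def field_simps)
  have V: "V > 0"
    by (simp add: V_def)
  have w0: "w y \<ge> 0" for y
    by (auto simp: w_def indicator_def disc hemi)
  have int_h: "has_bochner_integral ?M (h r) (V * r ^ CARD('n) / 2)" if "r > 0" for r
    using has_bochner_integral_hyperplane_height[OF that, of k] by (simp add: h_def[abs_def] S_def V_def)
  have int_q: "has_bochner_integral ?M (q m)
      ((V * 1 ^ CARD('n) / 2 - V * (1 - d m) ^ CARD('n) / 2) / d m)" for m
    unfolding q_def using d[of m]
    by (intro has_bochner_integral_divide_zero has_bochner_integral_diff int_h) auto
  have lim: "(\<lambda>m. integral\<^sup>L ?M (q m)) \<longlonglongrightarrow> real CARD('n) * V / 2"
  proof -
    \<comment> \<open>The integrals of the \<open>q m\<close> are left difference quotients of the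
      half-ball volume at radius 1, so their limit is its derivative there.\<close>
    have "((\<lambda>r. V * r ^ CARD('n) / 2) has_real_derivative real CARD('n) * V / 2) (at 1)"
      by (auto intro!: derivative_eq_intros)
    from tendsto_left_difference_quotient[OF this] show ?thesis
      using has_bochner_integral_integral_eq[OF int_q] by (simp add: d_def)
  qed
  have q_bounds: "0 \<le> q m y \<and> q m y \<le> 2 * w y" if y: "y \<in> space ?M" for m y
  proof (cases "S y < 1")
    case False
    have "(1 - d m)\<^sup>2 \<le> 1"
      using d[of m] by (simp add: power_le_one)
    then have "q m y = 0"
      using False by (simp add: q_def h_def max_def)
    then show ?thesis using w0 by simp
  next
    case True
    define s where "s = sqrt (1 - S y)"
    define r where "r = 1 - d m"
    have s: "s > 0" "s\<^sup>2 = 1 - S y" "h 1 y = s"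
      using True by (auto simp: s_def h_def)
    have w: "w y = 1 / s"
      using True y by (simp add: w_def disc hemi s_def)
    have r: "0 < r" "r < 1" "d m = 1 - r"
      using d[of m] by (auto simp: r_def)
    have r2: "r\<^sup>2 \<le> 1" using r by (simp add: power_le_one)
    have hr: "0 \<le> h r y" "h r y \<le> s"
      using r2 True by (auto simp: h_def s_def)
    \<comment> \<open>If the ball of radius \<open>r\<close> still reaches \<open>y\<close>,
      multiply by the conjugate: (s - h)(s + h) = 1 - r^2. Otherwise h = 0 and s^2 = 1 - S y is
      below 1 - r^2. The factor 1 + r <= 2 then produces the 2 in the dominating function
      \<open>2 * w\<close>.\<close>
    have "(s - h r y) * s \<le> 1 - r\<^sup>2"
    proof (cases "S y \<le> r\<^sup>2")
      case True
      then have "(h r y)\<^sup>2 = r\<^sup>2 - S y" by (simp add: h_def)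
      then have "(s - h r y) * (s + h r y) = 1 - r\<^sup>2"
        using s by (simp add: power2_eq_square algebra_simps)
      moreover have "(s - h r y) * s \<le> (s - h r y) * (s + h r y)"
        using hr by (intro mult_left_mono) auto
      ultimately show ?thesis by simp
    next
      case False
      then have "(s - h r y) * s = 1 - S y"
        using s by (simp add: h_def power2_eq_square)
      then show ?thesis using False by simp
    qed
    also have "1 - r\<^sup>2 = (1 + r) * (1 - r)"
      by (simp add: power2_eq_square algebra_simps)
    also have "\<dots> \<le> 2 * (1 - r)"
      using r by (intro mult_right_mono) auto
    finally have "(s - h r y) * s \<le> 2 * (1 - r)" .
    then have "(s - h r y) / (1 - r) \<le> 2 / s"
      using r s by (simp add: field_simps)
    moreover have "q m y = (s - h r y) / (1 - r)"
      using s r by (simp add: q_def)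
    ultimately show ?thesis
      using w hr r by simp
  qed
  have q_lim: "(\<lambda>m. q m y) \<longlonglongrightarrow> w y" if y: "y \<in> space ?M" for y
  proof (cases "S y < 1")
    case False
    \<comment> \<open>Off the open disc \<open>w\<close> vanishes through its indicator, so the two
      bounds pinch \<open>q m y\<close> to 0. This includes the rim \<open>S y = 1\<close>, where
      the density itself blows up.\<close>
    have "q m y = 0" for m
      using q_bounds[OF y, of m] False by (simp add: w_def disc)
    then show ?thesis
      using False by (simp add: w_def disc)
  next
    case True
    have deriv: "((\<lambda>r. sqrt (r\<^sup>2 - S y)) has_real_derivative w y) (at 1)"
      using True y by (auto intro!: derivative_eq_intros simp: w_def disc hemi field_simps)
    \<comment> \<open>Near r = 1 the truncation in \<open>h\<close> is inactive, so the derivative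
      of the plain square root transfers to \<open>h\<close>.\<close>
    have "((\<lambda>r::real. r\<^sup>2) \<longlongrightarrow> 1) (nhds 1)"
      using tendsto_power[OF filterlim_ident, of 2 "1::real"] by simp
    then have "eventually (\<lambda>r. r\<^sup>2 > S y) (nhds (1::real))"
      using True by (rule order_tendstoD(1))
    then have "eventually (\<lambda>r. sqrt (r\<^sup>2 - S y) = h r y) (nhds (1::real))"
      by (rule eventually_mono) (simp add: h_def)
    from DERIV_cong_ev[OF refl this refl] deriv
    have "((\<lambda>r. h r y) has_real_derivative w y) (at 1)"
      by (rule iffD1)
    from tendsto_left_difference_quotient[OF this] show ?thesis
      by (simp add: q_def d_def)
  qed
  have int_w: "integrable ?M w"
  proof (rule integrableI_nonneg)
    have nn_q: "(\<integral>\<^sup>+y. ennreal (q m y) \<partial>?M) = ennreal (integral\<^sup>L ?M (q m))" for m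
      using int_q q_bounds
      by (intro nn_integral_eq_integral) (auto simp: has_bochner_integral_iff)
    have "(\<integral>\<^sup>+y. ennreal (w y) \<partial>?M) = (\<integral>\<^sup>+y. liminf (\<lambda>m. ennreal (q m y)) \<partial>?M)"
      by (intro nn_integral_cong lim_imp_Liminf[symmetric] tendsto_ennrealI q_lim) auto
    also have "\<dots> \<le> liminf (\<lambda>m. \<integral>\<^sup>+y. ennreal (q m y) \<partial>?M)"
      by (rule nn_integral_liminf) measurable
    also have "\<dots> = ennreal (real CARD('n) * V / 2)"
      unfolding nn_q by (intro lim_imp_Liminf tendsto_ennrealI lim) auto
    finally show "(\<integral>\<^sup>+y. ennreal (w y) \<partial>?M) < \<infinity>"
      by (simp add: le_less_trans)
  qed (use w0 in auto)
  have "(\<lambda>m. integral\<^sup>L ?M (q m)) \<longlonglongrightarrow> integral\<^sup>L ?M w"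
  proof (rule integral_dominated_convergence)
    show "integrable ?M (\<lambda>y. 2 * w y)" using int_w by simp
    show "AE y in ?M. (\<lambda>m. q m y) \<longlonglongrightarrow> w y" using q_lim by simp
    show "AE y in ?M. norm (q m y) \<le> 2 * w y" for m using q_bounds[of _ m] by auto
  qed measurable
  from LIMSEQ_unique[OF this lim] show ?thesis
    by (simp add: set_lebesgue_integral_def w_def[abs_def] V_def)
qed

lemma graph_area_cong:
  assumes "\<And>y. y \<in> U \<Longrightarrow>
      sqrt (1 + (\<Sum>j\<in>UNIV - {k}. (deriv (\<lambda>t. g (y(j := t))) (y j))\<^sup>2)) = f y"
  shows "graph_area k g U = (LINT y:U|hyperplane_measure k. f y)"
  unfolding graph_area_def set_lebesgue_integral_def
  by (intro Bochner_Integration.integral_cong) (auto simp: indicator_def assms)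

text \<open>Splitting the \<open>j\<close>-th square off the sum isolates the dependence on
  \<open>t\<close>; in the open disc the radicand is positive, so the root is
  differentiable.\<close>

lemma DERIV_hemisphere_fun:
  fixes k j :: "'n::finite"
  assumes y: "y \<in> hyperplane_disc k 1" and j: "j \<noteq> k"
  shows "((\<lambda>t. hemisphere_fun k 1 (y(j := t))) has_real_derivative - y j / hemisphere_fun k 1 y)
           (at (y j))"
proof -
  let ?R = "\<Sum>i\<in>UNIV - {k} - {j}. (y i)\<^sup>2"
  have eq: "hemisphere_fun k 1 (y(j := t)) = sqrt (1 - (t\<^sup>2 + ?R))" for t
  proof -
    have "(\<Sum>i\<in>UNIV - {k}. ((y(j := t)) i)\<^sup>2) = t\<^sup>2 + (\<Sum>i\<in>UNIV - {k} - {j}. ((y(j := t)) i)\<^sup>2)"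
      using j by (subst sum.remove[of _ j]) auto
    also have "(\<Sum>i\<in>UNIV - {k} - {j}. ((y(j := t)) i)\<^sup>2) = ?R"
      by (intro sum.cong) auto
    finally show ?thesis by (simp add: hemisphere_fun_def)
  qed
  have "1 - ((y j)\<^sup>2 + ?R) > 0"
    using y j by (simp add: hyperplane_disc_def sum.remove[of _ j])
  then have "((\<lambda>t. sqrt (1 - (t\<^sup>2 + ?R))) has_real_derivative - y j / sqrt (1 - ((y j)\<^sup>2 + ?R)))
      (at (y j))"
    by (auto intro!: derivative_eq_intros simp: field_simps)
  then show ?thesis
    using eq[of "y j"] by (simp add: eq)
qed

text \<open>With height h and h^2 + |y|^2 = 1, the squared gradient of the graph is |y|^2 / h^2, so
  the area element is sqrt(1 + |y|^2 / h^2) = 1 / h. The sign \<open>s\<close> treats both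
  hemispheres at once, since only its square enters. The value is the same for every
  \<open>k\<close>, which settles the \<open>SOME\<close> in the definition.\<close>

lemma sphere_area_1:
  "sphere_area TYPE('n::finite) 1 = real CARD('n) * unit_ball_vol (real CARD('n))"
proof -
  have "graph_area k (\<lambda>y. s * hemisphere_fun k 1 y) (hyperplane_disc k 1) =
          real CARD('n) * unit_ball_vol (real CARD('n)) / 2"
    if s: "s\<^sup>2 = 1" for k :: 'n and s :: real
  proof (subst graph_area_cong[where f = "\<lambda>y. 1 / hemisphere_fun k 1 y"])
    fix y :: "'n \<Rightarrow> real"
    assume y: "y \<in> hyperplane_disc k 1"
    let ?h = "hemisphere_fun k 1 y"
    let ?S = "\<Sum>j\<in>UNIV - {k}. (y j)\<^sup>2"
    have h: "?h > 0" "?h\<^sup>2 = 1 - ?S"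
      using y by (auto simp: hyperplane_disc_def hemisphere_fun_def)
    have "(deriv (\<lambda>t. s * hemisphere_fun k 1 (y(j := t))) (y j))\<^sup>2 = (y j)\<^sup>2 / ?h\<^sup>2"
      if "j \<in> UNIV - {k}" for j
    proof -
      have "deriv (\<lambda>t. s * hemisphere_fun k 1 (y(j := t))) (y j) = s * (- y j / ?h)"
        using that y by (intro DERIV_imp_deriv DERIV_cmult DERIV_hemisphere_fun) auto
      then show ?thesis using s by (simp add: power_mult_distrib power_divide)
    qed
    then have "1 + (\<Sum>j\<in>UNIV - {k}. (deriv (\<lambda>t. s * hemisphere_fun k 1 (y(j := t))) (y j))\<^sup>2) =
        1 + ?S / ?h\<^sup>2"
      by (simp add: sum_divide_distrib)
    also have "\<dots> = (1 / ?h)\<^sup>2"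
      using h by (simp add: field_simps)
    finally show "sqrt (1 + (\<Sum>j\<in>UNIV - {k}. (deriv (\<lambda>t. s * hemisphere_fun k 1 (y(j := t))) (y j))\<^sup>2))
        = 1 / ?h"
      using h(1) by simp
  qed (rule integral_hemisphere_density)
  from this[of 1 "SOME k. True"] this[of "-1" "SOME k. True"] show ?thesis
    by (simp add: sphere_area_def Let_def)
qed

text \<open>Integrating V r^n over [0, 1] gives V / (n + 1), and the sphere has area n V; the unit
  ball volume V cancels.\<close>

lemma kappa_eq: "kappa TYPE('n::finite) = 1 / (real CARD('n) * (real CARD('n) + 1))"
proof -
  let ?V = "unit_ball_vol (real CARD('n))"
  let ?n = "CARD('n)"
  have "((\<lambda>r. ?V * r ^ ?n) has_integral
      ?V * 1 ^ Suc ?n / real (Suc ?n) - ?V * 0 ^ Suc ?n / real (Suc ?n)) {0..1}"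
  proof (rule fundamental_theorem_of_calculus)
    fix x :: real
    show "((\<lambda>r. ?V * r ^ Suc ?n / real (Suc ?n)) has_vector_derivative ?V * x ^ ?n)
        (at x within {0..1})"
      unfolding has_real_derivative_iff_has_vector_derivative[symmetric]
      by (auto intro!: derivative_eq_intros simp del: power_Suc of_nat_Suc)
  qed simp
  then have "((\<lambda>r. ball_volume TYPE('n) r) has_integral ?V / real (Suc ?n)) {0..1}"
    by (rule has_integral_eq[rotated, THEN has_integral_eq_rhs])
      (auto simp: ball_volume_def content_ball)
  then have "integral {0..1} (ball_volume TYPE('n)) = ?V / (real ?n + 1)"
    by (simp add: integral_unique add.commute)
  moreover have "?V \<noteq> 0"
    by (rule less_imp_neq[THEN not_sym]) simp
  ultimately show ?thesis
    by (simp add: kappa_def sphere_area_1)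
qed

section \<open>A maximum principle on the unit ball\<close>

text \<open>At the maximum \<open>f'\<close> vanishes. If \<open>l\<close> were positive,
  \<open>f'\<close> would be positive just to the right of 0, and \<open>f\<close> would rise above
  its maximum.\<close>

lemma local_max_second_derivative_nonpos:
  fixes f f' :: "real \<Rightarrow> real"
  assumes "d > 0"
    and f: "\<And>t. \<bar>t\<bar> < d \<Longrightarrow> (f has_real_derivative f' t) (at t)"
    and f': "(f' has_real_derivative l) (at 0)"
    and le: "\<And>t. \<bar>t\<bar> < d \<Longrightarrow> f t \<le> f 0"
  shows "l \<le> 0"
proof (rule ccontr)
  assume "\<not> l \<le> 0"
  have "f' 0 = 0"
    using DERIV_local_max[OF f[of 0] \<open>d > 0\<close>] le \<open>d > 0\<close> by simp
  then obtain e where e: "e > 0" "\<And>h. 0 < h \<Longrightarrow> h < e \<Longrightarrow> f' h > 0"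
    using DERIV_pos_inc_right[OF f'] \<open>\<not> l \<le> 0\<close> by auto
  define b where "b = min d e / 2"
  have b: "0 < b" "b < d" "b < e"
    using \<open>d > 0\<close> \<open>e > 0\<close> by (auto simp: b_def)
  have "f 0 < f b"
  proof (rule DERIV_pos_imp_increasing_open[of 0 b f])
    show "continuous_on {0..b} f"
      using b by (intro continuous_at_imp_continuous_on ballI DERIV_isCont[OF f]) simp
    show "\<exists>y. (f has_real_derivative y) (at x) \<and> 0 < y" if "0 < x" "x < b" for x
      using f[of x] e(2)[of x] that b by auto
  qed (use b in auto)
  then show False using le[of b] b by auto
qed

text \<open>The maximum principle receives its derivatives at parameter 0 from each base point; this
  moves them to an arbitrary parameter on one fixed line.\<close>

lemma DERIV_along_line:
  fixes f :: "'a::real_normed_vector \<Rightarrow> real"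
  assumes "((\<lambda>s. f (x + t *\<^sub>R e + s *\<^sub>R e)) has_real_derivative D) (at 0)"
  shows "((\<lambda>t. f (x + t *\<^sub>R e)) has_real_derivative D) (at t)"
proof -
  have "f (x + (s + t) *\<^sub>R e) = f (x + t *\<^sub>R e + s *\<^sub>R e)" for s
    by (simp add: scaleR_add_left add_ac)
  then show ?thesis
    using assms DERIV_shift[of "\<lambda>t. f (x + t *\<^sub>R e)" D 0 t] by simp
qed

text \<open>Compare with a paraboloid of Laplacian L < K. An interior maximum p of the difference on
  a closed ball of radius r < 1 would force the sum of the \<open>H i p\<close> to be at most L. So
  the maximum lies on the sphere, where the paraboloid has the constant value L r^2 / (2 n); then
  let r tend to 1 and L to K.\<close>

lemma bound_at_center_if_laplacian_ge:
  fixes v :: "real ^ 'n::finite \<Rightarrow> real"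
  assumes cont: "continuous_on (ball 0 1) v"
    and G: "\<And>i x. x \<in> ball 0 1 \<Longrightarrow>
        ((\<lambda>t. v (x + t *\<^sub>R axis i 1)) has_real_derivative G i x) (at 0)"
    and H: "\<And>i x. x \<in> ball 0 1 \<Longrightarrow>
        ((\<lambda>t. G i (x + t *\<^sub>R axis i 1)) has_real_derivative H i x) (at 0)"
    and K: "\<And>x. x \<in> ball 0 1 \<Longrightarrow> (\<Sum>i\<in>UNIV. H i x) \<ge> K"
    and m: "\<And>x. x \<in> ball 0 1 \<Longrightarrow> v x \<le> m"
  shows "v 0 \<le> m - K / (2 * real CARD('n))"
proof -
  let ?n = "real CARD('n)"
  have est: "v 0 \<le> m - L / (2 * ?n) * r\<^sup>2" if r: "0 < r" "r < 1" and L: "L < K" for r L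
  proof -
    define c where "c = L / (2 * ?n)"
    define w where "w x = v x - c * (x \<bullet> x)" for x :: "real ^ 'n"
    have sub: "cball 0 r \<subseteq> (ball 0 1 :: (real ^ 'n) set)"
      using r by (auto simp: subset_iff)
    have "continuous_on (cball 0 r) w"
      unfolding w_def by (intro continuous_intros continuous_on_subset[OF cont] sub)
    then obtain p where p: "p \<in> cball 0 r" and max: "\<And>x. x \<in> cball 0 r \<Longrightarrow> w x \<le> w p"
      using continuous_attains_sup[of "cball (0 :: real ^ 'n) r" w] r by auto
    have "norm p = r"
    proof (rule ccontr)
      assume "norm p \<noteq> r"
      then have d: "r - norm p > 0" using p by simp
      have p1: "p \<in> ball 0 1" using p sub by blast
      have "H i p - 2 * c \<le> 0" for i
      proof (rule local_max_second_derivative_nonpos[OF d])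
        let ?e = "axis i 1 :: real ^ 'n"
        have ball: "p + t *\<^sub>R ?e \<in> cball 0 r" if "\<bar>t\<bar> < r - norm p" for t
          using norm_triangle_ineq[of p "t *\<^sub>R ?e"] that by simp
        \<comment> \<open>Along an axis the subtracted term is a quadratic polynomial in
          \<open>t\<close> with second derivative \<open>2 * c\<close>; summed over the
          \<open>n\<close> axes this is \<open>L\<close>.\<close>
        have quad: "w (p + t *\<^sub>R ?e) = v (p + t *\<^sub>R ?e) - c * (p \<bullet> p + 2 * t * (p $ i) + t\<^sup>2)" for t
          by (simp add: w_def inner_add_left inner_add_right inner_axis inner_axis'
              power2_eq_square algebra_simps)
        show "((\<lambda>t. w (p + t *\<^sub>R ?e)) has_real_derivative
            G i (p + t *\<^sub>R ?e) - c * (2 * p $ i + 2 * t)) (at t)" if "\<bar>t\<bar> < r - norm p" for t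
        proof -
          have "((\<lambda>t. v (p + t *\<^sub>R ?e)) has_real_derivative G i (p + t *\<^sub>R ?e)) (at t)"
            using G[of "p + t *\<^sub>R ?e" i] ball[OF that] sub
            by (intro DERIV_along_line[of v p t ?e]) blast
          then show ?thesis
            unfolding quad by (auto intro!: derivative_eq_intros)
        qed
        show "((\<lambda>t. G i (p + t *\<^sub>R ?e) - c * (2 * p $ i + 2 * t)) has_real_derivative
            H i p - 2 * c) (at 0)"
          by (auto intro!: derivative_eq_intros H[OF p1])
        show "w (p + t *\<^sub>R ?e) \<le> w (p + 0 *\<^sub>R ?e)" if "\<bar>t\<bar> < r - norm p" for t
          using max[OF ball[OF that]] by simp
      qed
      then have "(\<Sum>i\<in>UNIV. H i p) \<le> (\<Sum>i\<in>(UNIV :: 'n set). 2 * c)"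
        by (intro sum_mono) (simp add: algebra_simps)
      also have "\<dots> = L"
        by (simp add: c_def)
      finally show False
        using K[OF p1] L by simp
    qed
    then have "p \<bullet> p = r\<^sup>2"
      by (simp add: dot_square_norm)
    moreover have "w 0 \<le> w p" using max[of 0] r by simp
    moreover have "v p \<le> m" using m p sub by blast
    ultimately show ?thesis by (simp add: w_def c_def)
  qed
  \<comment> \<open>One parameter drives both limits: \<open>s\<close> is the radius, and the slack
    \<open>K - L\<close> is \<open>1 - s\<close>.\<close>
  have "((\<lambda>s. m - (K - (1 - s)) / (2 * ?n) * s\<^sup>2) \<longlongrightarrow> m - K / (2 * ?n)) (at_left 1)"
    by (auto intro!: tendsto_eq_intros)
  moreover have "eventually (\<lambda>s::real. v 0 \<le> m - (K - (1 - s)) / (2 * ?n) * s\<^sup>2) (at_left 1)"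
  proof (rule eventually_mono)
    show "eventually (\<lambda>s::real. s \<in> {0<..<1}) (at_left 1)"
      by (rule eventually_at_left_real) simp
    show "v 0 \<le> m - (K - (1 - s)) / (2 * ?n) * s\<^sup>2" if "s \<in> {0<..<1}" for s
      using est[of s "K - (1 - s)"] that by simp
  qed
  ultimately show ?thesis
    by (rule tendsto_lowerbound) simp
qed

section \<open>The differential inequality for a power of \<open>u\<close>\<close>

text \<open>The chain rule along an axis turns Frechet partial derivatives into the one-variable
  derivatives used by the maximum principle.\<close>

lemma DERIV_partial_deriv:
  fixes f :: "real ^ 'n::finite \<Rightarrow> real"
  assumes "f differentiable at x"
  shows "((\<lambda>t. f (x + t *\<^sub>R axis i 1)) has_real_derivative partial_deriv i f x) (at 0)"
proof -
  interpret linear "frechet_derivative f (at x)"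
    using assms by (rule linear_frechet_derivative)
  have "(f has_derivative frechet_derivative f (at x)) (at (x + 0 *\<^sub>R axis i 1))"
    using assms by (simp add: frechet_derivative_works)
  moreover have "((\<lambda>t. x + t *\<^sub>R axis i 1) has_derivative (\<lambda>t. t *\<^sub>R axis i 1)) (at 0)"
    by (auto intro!: derivative_eq_intros)
  ultimately have "((\<lambda>t. f (x + t *\<^sub>R axis i 1)) has_derivative
      (\<lambda>t. frechet_derivative f (at x) (t *\<^sub>R axis i 1))) (at 0)"
    using has_derivative_compose by blast
  then show ?thesis
    by (rule has_derivative_imp_has_field_derivative)
      (simp add: partial_deriv_def scale)
qed

text \<open>The power \<open>u powr (1 - C)\<close> absorbs the gradient term: its Laplacian is
  \<open>(1 - C) * u powr (- C - 1) * (u * laplacian u - C * (norm (gradient u))\<^sup>2)\<close>.\<close>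

lemma positive_subsolution_upper_bound:
  fixes u :: "real ^ 'n::finite \<Rightarrow> real"
  assumes B: "B > 0" and C: "C < 1" and \<epsilon>: "\<epsilon> \<le> C"
    and C2: "Ck_on 2 (ball 0 1) u"
    and pos: "\<And>x. x \<in> ball 0 1 \<Longrightarrow> u x > 0"
    and ineq: "\<And>x. x \<in> ball 0 1 \<Longrightarrow>
           u x * laplacian u x \<ge> B * \<bar>u x\<bar> powr (1 + \<epsilon>) + C * (norm (gradient u x))\<^sup>2"
    and m: "\<And>x. x \<in> ball 0 1 \<Longrightarrow> u x \<le> m"
  shows "(1 - C) * B * m powr (\<epsilon> - C) / (2 * real CARD('n)) < m powr (1 - C)"
proof -
  define G where "G i x = (1 - C) * u x powr (- C) * partial_deriv i u x" for i x
  define H where "H i x = (1 - C) * u x powr (- C - 1) *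
      (u x * partial_deriv i (partial_deriv i u) x - C * (partial_deriv i u x)\<^sup>2)" for i x
  have diff: "u differentiable at x" "partial_deriv i u differentiable at x"
    if "x \<in> ball 0 1" for i x
    using C2 that by (auto simp: numeral_2_eq_2)
  have "u 0 powr (1 - C) \<le> m powr (1 - C) - (1 - C) * B * m powr (\<epsilon> - C) / (2 * real CARD('n))"
  proof (rule bound_at_center_if_laplacian_ge[where G = G and H = H])
    have "continuous_on (ball 0 1) u"
      using diff(1) by (intro differentiable_imp_continuous_on)
        (auto simp: differentiable_on_def intro: differentiable_at_withinI)
    then show "continuous_on (ball 0 1) (\<lambda>x. u x powr (1 - C))"
      using pos by (intro continuous_intros) (auto simp: less_le)
  next
    fix i and x :: "real ^ 'n"
    assume x: "x \<in> ball 0 1"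
    note d = DERIV_partial_deriv[OF diff(1)[OF x], of i] DERIV_partial_deriv[OF diff(2)[OF x], of i i]
    have u0: "u (x + 0 *\<^sub>R axis i 1) > 0" using pos[OF x] by simp
    have dpow: "((\<lambda>t. u (x + t *\<^sub>R axis i 1) powr a) has_real_derivative
        a * u x powr (a - 1) * partial_deriv i u x) (at 0)" for a
      using DERIV_powr[OF d(1) u0 DERIV_const[of a]] pos[OF x]
      by (simp add: powr_diff field_simps)
    show "((\<lambda>t. u (x + t *\<^sub>R axis i 1) powr (1 - C)) has_real_derivative G i x) (at 0)"
      using dpow[of "1 - C"] by (simp add: G_def)
    have "((\<lambda>t. G i (x + t *\<^sub>R axis i 1)) has_real_derivative
        (1 - C) * (- C * u x powr (- C - 1) * partial_deriv i u x * partial_deriv i u x +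
          partial_deriv i (partial_deriv i u) x * u x powr (- C))) (at 0)"
      unfolding G_def mult.assoc[of "1 - C"]
      using DERIV_cmult[OF DERIV_mult[OF dpow[of "- C"] d(2)], of "1 - C"] by simp
    \<comment> \<open>Extracting one factor \<open>u x\<close> gives both terms the common power
      \<open>- C - 1\<close> that appears in \<open>H\<close>.\<close>
    moreover have "u x powr (- C) = u x powr (- C - 1) * u x"
      using pos[OF x] by (simp add: powr_diff)
    ultimately show "((\<lambda>t. G i (x + t *\<^sub>R axis i 1)) has_real_derivative H i x) (at 0)"
      by (simp add: H_def power2_eq_square algebra_simps)
  next
    fix x :: "real ^ 'n"
    assume x: "x \<in> ball 0 1"
    \<comment> \<open>The exponent \<open>\<epsilon> - C\<close> is at most 0, so the upper bound on
      \<open>u\<close> becomes a lower bound on this power. This is where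
      \<open>\<epsilon> \<le> C\<close> enters.\<close>
    have "(1 - C) * B * m powr (\<epsilon> - C) \<le> (1 - C) * B * u x powr (\<epsilon> - C)"
      using B C \<epsilon> pos[OF x] m[OF x] by (intro mult_left_mono powr_mono2') auto
    also have "\<dots> = (1 - C) * u x powr (- C - 1) * (B * u x powr (1 + \<epsilon>))"
      by (simp add: powr_add[symmetric] mult_ac)
    also have "\<dots> \<le> (1 - C) * u x powr (- C - 1) * (u x * laplacian u x - C * (norm (gradient u x))\<^sup>2)"
      using ineq[OF x] pos[OF x] C by (intro mult_left_mono) auto
    also have "(norm (gradient u x))\<^sup>2 = (\<Sum>i\<in>UNIV. (partial_deriv i u x)\<^sup>2)"
      by (simp add: norm_vec_def L2_set_def sum_nonneg gradient_def)
    also have "(1 - C) * u x powr (- C - 1) * (u x * laplacian u x - C * \<dots>) = (\<Sum>i\<in>UNIV. H i x)"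
      by (simp add: H_def laplacian_def sum_distrib_left[symmetric] sum_subtractf)
    finally show "(1 - C) * B * m powr (\<epsilon> - C) \<le> (\<Sum>i\<in>UNIV. H i x)" .
    show "u x powr (1 - C) \<le> m powr (1 - C)"
      using pos[OF x] m[OF x] C by (intro powr_mono2) auto
  qed
  \<comment> \<open>Positivity at the center is what makes the final inequality strict.\<close>
  moreover have "u 0 powr (1 - C) > 0"
    using pos[of 0] by simp
  ultimately show ?thesis by linarith
qed

section \<open>Contradiction with the value of \<open>kappa\<close>\<close>

theorem theorem5p2:
  fixes u :: "real ^ 'n::finite \<Rightarrow> real" and B C \<epsilon> M :: real
  assumes "B > 0" and "C < 1" and "\<epsilon> \<le> C"
    and M_def: "M = ((1 - C) * B * kappa TYPE('n)) powr (1 / (1 - \<epsilon>))"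
    and "Ck_on 2 (ball 0 1) u"
    and "\<And>x. x \<in> ball 0 1 \<Longrightarrow> u x > 0"
    and "\<And>x. x \<in> ball 0 1 \<Longrightarrow>
           u x * laplacian u x \<ge> B * \<bar>u x\<bar> powr (1 + \<epsilon>) + C * (norm (gradient u x))\<^sup>2"
  shows "M > 0 \<and> (SUP x\<in>ball 0 1. ereal (u x)) > ereal M"
proof
  let ?n = "real CARD('n)"
  define \<kappa> where "\<kappa> = kappa TYPE('n)"
  have n: "?n \<ge> 1"
    using zero_less_card_finite[where 'a = 'n] by linarith
  have \<kappa>: "\<kappa> = 1 / (?n * (?n + 1))"
    by (simp add: \<kappa>_def kappa_eq)
  have "\<kappa> > 0"
    using n by (simp add: \<kappa>)
  then have base: "(1 - C) * B * \<kappa> > 0"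
    using assms(1,2) by simp
  then show "M > 0"
    unfolding M_def \<kappa>_def by (simp add: less_le)
  show "(SUP x\<in>ball 0 1. ereal (u x)) > ereal M"
  proof (rule ccontr)
    assume "\<not> ?thesis"
    then have "u x \<le> M" if "x \<in> ball 0 1" for x
      using SUP_le_iff[of "\<lambda>x. ereal (u x)" "ball 0 1" "ereal M"] that by (simp add: not_less)
    then have "(1 - C) * B * M powr (\<epsilon> - C) / (2 * ?n) < M powr (1 - C)"
      using positive_subsolution_upper_bound[of B C \<epsilon> u M] assms by blast
    \<comment> \<open>Splitting the exponent 1 - C as (1 - \<epsilon>) + (\<epsilon> - C) exposes a
      factor shared with the left side; the other factor undoes the root in the definition of
      \<open>M\<close>, as 1 - \<epsilon> > 0.\<close>
    also have "M powr (1 - C) = M powr (1 - \<epsilon>) * M powr (\<epsilon> - C)"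
      by (simp flip: powr_add)
    also have "M powr (1 - \<epsilon>) = (1 - C) * B * \<kappa>"
      using base assms(2,3) by (simp add: M_def \<kappa>_def powr_powr)
    finally have "((1 - C) * B * M powr (\<epsilon> - C)) * (1 / (2 * ?n)) <
        ((1 - C) * B * M powr (\<epsilon> - C)) * \<kappa>"
      by (simp add: mult_ac)
    moreover have "(1 - C) * B * M powr (\<epsilon> - C) > 0"
      using \<open>M > 0\<close> assms(1,2) by simp
    ultimately have "1 / (2 * ?n) < \<kappa>"
      using mult_less_cancel_left_pos by blast
    \<comment> \<open>This is n + 1 >= 2. Equality holds for n = 1, so the contradiction there
      relies on the strict inequality just obtained.\<close>
    moreover have "\<kappa> \<le> 1 / (2 * ?n)"
      unfolding \<kappa> using n by (intro divide_left_mono) (auto simp: mult.commute)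
    ultimately show False by simp
  qed
qed

end
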